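(* Let $\mathbb{U}$ be a reflexive separable Banach space with topological dual $\mathbb{U}^\star$, let $(\Omega,\mathcal{A},\mathbb{P})$ be a probability space, and let $\mathbb{W}$ be a topological vector space equipped with its Borel $\sigma$-field. Let $\varepsilon>0$. Assume: (1) $U^{\mathrm{ad}}$ is a non-empty closed convex subset of $\mathbb{U}$; (2) $j^{\Sigma}:\mathbb{U}\times\mathbb{W}\to\mathbb{R}$ is jointly lower semicontinuous and, for all $w\in\mathbb{W}$, $j^{\Sigma}(\cdot,w)$ is proper and convex; (3) $K:\mathbb{U}\to\mathbb{R}$ is proper, convex, lower semicontinuous, and Gateaux-differentiable on an open set containing $U^{\mathrm{ad}}$; (4) the $\sigma$-field $\mathcal{A}$ is complete for $\mathbb{P}$; (5) $\mathbf{W}:\Omega\to\mathbb{W}$ is measurable; (6) $\boldsymbol{\varphi}:\Omega\to\mathbb{U}^\star$ is measurable (with respect to the Borel $\sigma$-field of the dual norm topology on $\mathbb{U}^\star$); (7) for all $\omega\in\Omega$, the function $u\mapsto\Phi(\omega,u):=K(u)+\langle\boldsymbol{\varphi}(\omega),u\rangle+\varepsilon\, j^{\Sigma}(u,\mathbf{W}(\omega))$ is coercive on $U^{\mathrm{ad}}$, i.e. $\Phi(\omega,u)\to+\infty$ when $\|u\|\to+\infty$ with $u\in U^{\mathrm{ad}}$. Then the set-valued mapping $M:\Omega\rightrightarrows\mathbb{U}$ defined by $M(\omega)=\operatorname*{arg\,min}_{u\in U^{\mathrm{ad}}}\Phi(\omega,u)$ admits a measurable selection.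
   Context: $\langle\cdot,\cdot\rangle$ is the duality pairing between $\mathbb{U}^\star$ and $\mathbb{U}$. $\mathbb{U}$ carries its Borel $\sigma$-field. A measurable selection of a set-valued mapping $\Gamma:\Omega\rightrightarrows\mathbb{U}$ is a measurable function $\gamma:\Omega\to\mathbb{U}$ with $\gamma(\omega)\in\Gamma(\omega)$ for all $\omega\in\Omega$. Gateaux-differentiability includes linearity and boundedness of the directional derivative. $\mathcal{A}$ is complete for $\mathbb{P}$ if it contains every subset of every $\mathbb{P}$-null set of $\mathcal{A}$. *)

theory Defs
  imports "HOL-Probability.Probability"
begin

section \<open>Spaces\<close>

class separable_banach = banach +
  assumes separable: "\<exists>D. countable D \<and> (\<forall>S. open S \<longrightarrow> S \<noteq> {} \<longrightarrow> D \<inter> S \<noteq> {})"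

lemma separable_banach_separable_space:
  "separable_space (euclidean :: 'u::separable_banach topology)"
proof -
  obtain D :: "'u set" where D: "countable D" "\<And>S. open S \<Longrightarrow> S \<noteq> {} \<Longrightarrow> D \<inter> S \<noteq> {}"
    using separable by blast
  have "closure D = UNIV"
    using D(2) by (auto simp: dense_intersects_open[of euclidean D, simplified])
  then show ?thesis
    using D(1) unfolding separable_space_def by auto
qed

text \<open>A separable metric space is second countable, which makes the measurability
  lemmas of the library available on this class.\<close>

instance separable_banach \<subseteq> second_countable_topology
proof
  obtain D :: "'a set" where D: "countable D" "closure D = UNIV"
    using separable_banach_separable_space unfolding separable_space_def by auto
  define B where "B = (\<lambda>(x, n). ball x (1 / real (Suc n))) ` (D \<times> (UNIV :: nat set))"
  have "topological_basis B"
  proof (rule topological_basisI)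
    fix A :: "'a set" assume "A \<in> B"
    then show "open A" unfolding B_def by auto
  next
    fix A :: "'a set" and x assume "open A" "x \<in> A"
    then obtain e where e: "e > 0" "ball x e \<subseteq> A"
      by (meson openE)
    obtain n where n: "1 / real (Suc n) < e / 2"
      using nat_approx_posE[of "e / 2"] e by auto
    obtain d where d: "d \<in> D" "dist d x < 1 / real (Suc n)"
      using D(2) closure_approachable[of x D] by (metis UNIV_I divide_pos_pos of_nat_0_less_iff zero_less_Suc zero_less_one)
    have "ball d (1 / real (Suc n)) \<subseteq> ball x e"
    proof
      fix y assume "y \<in> ball d (1 / real (Suc n))"
      then show "y \<in> ball x e"
        using d n dist_triangle[of x y d] by (simp add: dist_commute)
    qed
    then show "\<exists>C\<in>B. x \<in> C \<and> C \<subseteq> A"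
      using d e unfolding B_def by (intro bexI[of _ "ball d (1 / real (Suc n))"]) auto
  qed
  moreover have "countable B" unfolding B_def using D by auto
  ultimately show "\<exists>B::'a set set. countable B \<and> open = generate_topology B"
    using topological_basis_imp_subbasis by blast
qed

text \<open>Topological vector spaces over the reals; the Hausdorff property is not required.\<close>

class real_topological_vector = real_vector + topological_ab_group_add +
  assumes tendsto_scaleR_nhds:
    "((\<lambda>p. fst p *\<^sub>R snd p) \<longlongrightarrow> a *\<^sub>R x) (nhds a \<times>\<^sub>F nhds x)"

definition bidual_embedding :: "'u::real_normed_vector \<Rightarrow> (('u \<Rightarrow>\<^sub>L real) \<Rightarrow>\<^sub>L real)"
  where "bidual_embedding u = Blinfun (\<lambda>f. blinfun_apply f u)"

text \<open>\<^const>\<open>Blinfun\<close> is meaningful only on bounded linear maps.\<close>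

lemma bidual_embedding_apply:
  "blinfun_apply (bidual_embedding u) f = blinfun_apply f u"
  unfolding bidual_embedding_def
  by (subst bounded_linear_Blinfun_apply) (auto intro: bounded_linear_intros)

definition reflexive_space :: "'u::banach itself \<Rightarrow> bool"
  where "reflexive_space _ \<longleftrightarrow> surj (bidual_embedding :: 'u \<Rightarrow> _)"

section \<open>Convex analysis\<close>

definition lower_semicontinuous :: "('a::topological_space \<Rightarrow> real) \<Rightarrow> bool"
  where "lower_semicontinuous f \<longleftrightarrow>
    (\<forall>x. \<forall>c < f x. eventually (\<lambda>y. c < f y) (nhds x))"

text \<open>Properness is a notion for extended-real-valued functions. A real-valued function \<open>f\<close>
  is read as the function \<open>\<lambda>x. ereal (f x)\<close>, which is then always proper.\<close>

definition proper_function :: "('a \<Rightarrow> ereal) \<Rightarrow> bool"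
  where "proper_function f \<longleftrightarrow> (\<forall>x. f x \<noteq> -\<infinity>) \<and> (\<exists>x. f x \<noteq> \<infinity>)"

definition gateaux_differentiable_at :: "('u::real_normed_vector \<Rightarrow> real) \<Rightarrow> 'u \<Rightarrow> bool"
  where "gateaux_differentiable_at f u \<longleftrightarrow>
    (\<exists>D. bounded_linear D \<and>
      (\<forall>v. ((\<lambda>t. (f (u + t *\<^sub>R v) - f u) / t) \<longlongrightarrow> D v) (at 0)))"

definition coercive_on :: "'u::real_normed_vector set \<Rightarrow> ('u \<Rightarrow> real) \<Rightarrow> bool"
  where "coercive_on S f \<longleftrightarrow> filterlim f at_top (inf at_infinity (principal S))"

definition argmin_on :: "'u set \<Rightarrow> ('u \<Rightarrow> real) \<Rightarrow> 'u set"
  where "argmin_on S f = {u. is_arg_min f (\<lambda>u. u \<in> S) u}"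

section \<open>The parametrized problem\<close>

definition aux_objective ::
  "('u::real_normed_vector \<Rightarrow> real) \<Rightarrow> ('\<omega> \<Rightarrow> ('u \<Rightarrow>\<^sub>L real)) \<Rightarrow> real
    \<Rightarrow> ('u \<times> 'w \<Rightarrow> real) \<Rightarrow> ('\<omega> \<Rightarrow> 'w) \<Rightarrow> '\<omega> \<Rightarrow> 'u \<Rightarrow> real"
  where "aux_objective K \<phi> \<epsilon> j W \<omega> u = K u + blinfun_apply (\<phi> \<omega>) u + \<epsilon> * j (u, W \<omega>)"

definition measurable_selection ::
  "'\<omega> measure \<Rightarrow> ('\<omega> \<Rightarrow> 'u::topological_space set) \<Rightarrow> ('\<omega> \<Rightarrow> 'u) \<Rightarrow> bool"
  where "measurable_selection P \<Gamma> \<gamma> \<longleftrightarrow>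
    \<gamma> \<in> measurable P borel \<and> (\<forall>\<omega>\<in>space P. \<gamma> \<omega> \<in> \<Gamma> \<omega>)"

end

theory Submission
  imports Defs
begin

text \<open>For each parameter the objective is finite, convex and lower semicontinuous, hence continuous
  (\<open>convex_lower_semicontinuous_imp_continuous\<close>), and in the parameter it is measurable, because a
  lower semicontinuous function of the noise is Borel. So the minimizers of a Caratheodory
  integrand are to be selected, and by the Kuratowski--Ryll-Nardzewski theorem
  (\<open>measurable_selection_infdist\<close>) it suffices that the distance from each fixed point to the set of
  minimizers is a measurable function of the parameter.

  That set is the intersection of the sets of \<open>1 / Suc n\<close>-minimizers, and comparing values at the
  points of a countable dense subset of the feasible set decides how far those are from a point.
  The distance passes to the intersection because in a reflexive space nested bounded closed
  convex sets have a common point (\<open>nested_convex_Inter_nonempty\<close>); the same fact yields the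
  existence of minimizers. The outcome is a description of the distance by countably many
  inequalities between values of the objective (\<open>infdist_argmin_on_le_iff\<close>).

  The intersection property rests on the Hahn-Banach theorem, used once on the dual space to
  produce the common point as an element of the bidual, and once on the space itself to separate
  a point from a closed convex set. Its proof and the separation argument share one construction
  on sublinear functionals (\<open>sublinear_lower_on_convex\<close>).\<close>

section \<open>Sublinear functionals and the Hahn-Banach theorem\<close>

definition sublinear :: "('a::real_vector \<Rightarrow> real) \<Rightarrow> bool"
  where "sublinear p \<longleftrightarrow>
    (\<forall>x y. p (x + y) \<le> p x + p y) \<and> (\<forall>t\<ge>0. \<forall>x. p (t *\<^sub>R x) = t * p x)"

lemma sublinear_add: "sublinear p \<Longrightarrow> p (x + y) \<le> p x + p y"
  by (simp add: sublinear_def)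

lemma sublinear_scaleR: "sublinear p \<Longrightarrow> 0 \<le> t \<Longrightarrow> p (t *\<^sub>R x) = t * p x"
  by (simp add: sublinear_def)

lemma sublinear_0: "sublinear p \<Longrightarrow> p 0 = 0"
  using sublinear_scaleR[of p 0 0] by simp

lemma sublinear_ge_neg: "sublinear p \<Longrightarrow> - p (- x) \<le> p x"
  using sublinear_add[of p x "- x"] sublinear_0[of p] by simp

lemma sublinearI:
  assumes add: "\<And>x y. p (x + y) \<le> p x + p y"
    and scale: "\<And>t x. 0 < t \<Longrightarrow> p (t *\<^sub>R x) \<le> t * p x"
    and zero: "p 0 \<le> 0"
  shows "sublinear p"
proof -
  have "p (t *\<^sub>R x) = t * p x" if "t \<ge> 0" for t x
  proof (cases "t = 0")
    case True
    then show ?thesis using zero add[of 0 0] by simp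
  next
    case False
    then have t: "t > 0" using that by simp
    have "p x \<le> inverse t * p (t *\<^sub>R x)"
      using scale[of "inverse t" "t *\<^sub>R x"] t by simp
    then have "t * p x \<le> p (t *\<^sub>R x)"
      using t by (simp add: field_simps)
    then show ?thesis using scale[OF t, of x] by simp
  qed
  then show ?thesis using add by (simp add: sublinear_def)
qed

lemma sublinear_Inf_chain:
  fixes F :: "('a::real_vector \<Rightarrow> real) set"
  assumes ne: "F \<noteq> {}" and sub: "\<And>p. p \<in> F \<Longrightarrow> sublinear p"
    and chain: "\<And>p q. p \<in> F \<Longrightarrow> q \<in> F \<Longrightarrow> p \<le> q \<or> q \<le> p"
  shows "sublinear (\<lambda>x. INF p\<in>F. p x)" (is "sublinear ?m")
    and "\<And>p x. p \<in> F \<Longrightarrow> (INF p\<in>F. p x) \<le> p x"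
proof -
  obtain p0 where p0: "p0 \<in> F" using ne by blast
  have bdd: "bdd_below ((\<lambda>p. p x) ` F)" for x
  proof (rule bdd_belowI2[of _ "- p0 (- x)"])
    fix p assume p: "p \<in> F"
    show "- p0 (- x) \<le> p x"
      using chain[OF p p0] sublinear_ge_neg[OF sub[OF p], of x] sublinear_ge_neg[OF sub[OF p0], of x]
      by (auto simp: le_fun_def) (metis neg_le_iff_le order_trans)+
  qed
  show lower: "?m x \<le> p x" if "p \<in> F" for p x
    using bdd that by (rule cINF_lower)
  show "sublinear ?m"
  proof (rule sublinearI)
    fix x y
    have pq: "?m (x + y) \<le> p x + q y" if p: "p \<in> F" and q: "q \<in> F" for p q
    proof -
      obtain r where r: "r \<in> F" "r \<le> p" "r \<le> q"
        using chain[OF p q] p q by blast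
      have "?m (x + y) \<le> r (x + y)" using r(1) by (rule lower)
      also have "\<dots> \<le> r x + r y" using sub[OF r(1)] by (rule sublinear_add)
      also have "\<dots> \<le> p x + q y" using r by (intro add_mono) (auto simp: le_fun_def)
      finally show ?thesis .
    qed
    have "?m (x + y) - ?m y \<le> p x" if p: "p \<in> F" for p
    proof -
      have "?m (x + y) - p x \<le> ?m y"
        using ne pq[OF p] by (intro cINF_greatest) (auto simp: algebra_simps)
      then show ?thesis by simp
    qed
    then have "?m (x + y) - ?m y \<le> ?m x"
      using ne by (intro cINF_greatest)
    then show "?m (x + y) \<le> ?m x + ?m y" by simp
  next
    fix t :: real and x :: 'a assume t: "0 < t"
    have "?m (t *\<^sub>R x) / t \<le> ?m x"
    proof (rule cINF_greatest[OF ne])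
      fix p assume p: "p \<in> F"
      show "?m (t *\<^sub>R x) / t \<le> p x"
        using lower[OF p, of "t *\<^sub>R x"] sublinear_scaleR[OF sub[OF p], of t x] t
        by (simp add: field_simps)
    qed
    then show "?m (t *\<^sub>R x) \<le> t * ?m x" using t by (simp add: field_simps)
  next
    show "?m 0 \<le> 0" using lower[OF p0, of 0] sublinear_0[OF sub[OF p0]] by simp
  qed
qed

text \<open>The functional \<open>\<lambda>y. INF t\<ge>0, c\<in>C. p (y + t *\<^sub>R c) - t * b\<close> is the largest sublinear one below
  \<open>p\<close> that is at most \<open>-b\<close> on \<open>-C\<close>; the bound \<open>b \<le> p c\<close> keeps the infimum
  finite. It serves twice: for a one-point set \<open>C = {x}\<close> and \<open>b = p x\<close> it shows that a minimal
  sublinear functional is odd, and for \<open>p\<close> the norm and \<open>C\<close> a convex set at distance \<open>b\<close> from the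
  origin it turns domination into separation.\<close>

lemma sublinear_lower_on_convex:
  assumes p: "sublinear p" and C: "convex C" "C \<noteq> {}" and b: "\<And>c. c \<in> C \<Longrightarrow> b \<le> p c"
  obtains q where "sublinear q" "q \<le> p" "\<And>c. c \<in> C \<Longrightarrow> q (- c) \<le> - b"
proof -
  define S where "S y = {p (y + t *\<^sub>R c) - t * b | t c. 0 \<le> t \<and> c \<in> C}" for y
  define q where "q y = Inf (S y)" for y
  have SI: "p (y + t *\<^sub>R c) - t * b \<in> S y" if "0 \<le> t" "c \<in> C" for y t c
    using that by (auto simp: S_def)
  obtain c0 where c0: "c0 \<in> C" using C by blast
  have ne: "S y \<noteq> {}" for y using SI[of 0 c0 y] c0 by auto
  have bdd: "bdd_below (S y)" for y
  proof (rule bdd_belowI[of _ "- p (- y)"])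
    fix s assume "s \<in> S y"
    then obtain t c where s: "s = p (y + t *\<^sub>R c) - t * b" "0 \<le> t" "c \<in> C"
      by (auto simp: S_def)
    have "t * b \<le> t * p c" using s b by (intro mult_left_mono)
    also have "\<dots> = p ((y + t *\<^sub>R c) + (- y))" using sublinear_scaleR[OF p s(2)] by simp
    also have "\<dots> \<le> p (y + t *\<^sub>R c) + p (- y)" using p by (rule sublinear_add)
    finally show "- p (- y) \<le> s" using s by simp
  qed
  have lower: "q y \<le> p (y + t *\<^sub>R c) - t * b" if "0 \<le> t" "c \<in> C" for y t c
    unfolding q_def using SI[OF that] bdd by (rule cInf_lower)
  have greatest: "l \<le> q y" if "\<And>t c. 0 \<le> t \<Longrightarrow> c \<in> C \<Longrightarrow> l \<le> p (y + t *\<^sub>R c) - t * b" for l y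
    unfolding q_def using that by (intro cInf_greatest ne) (auto simp: S_def)
  have "sublinear q"
  proof (rule sublinearI)
    fix x y
    have main: "q (x + y) \<le> (p (x + t *\<^sub>R c) - t * b) + (p (y + s *\<^sub>R d) - s * b)"
      if t: "0 \<le> t" and c: "c \<in> C" and s: "0 \<le> s" and d: "d \<in> C" for t c s d
    proof -
      obtain e where e: "e \<in> C" "(t + s) *\<^sub>R e = t *\<^sub>R c + s *\<^sub>R d"
      proof (cases "t + s = 0")
        case True
        then have "t = 0" "s = 0" using t s by auto
        then show ?thesis using that[of c] c by simp
      next
        case False
        have "(t / (t + s)) *\<^sub>R c + (s / (t + s)) *\<^sub>R d \<in> C"
          using False t s c d C(1) by (intro convexD) (auto simp: add_divide_distrib[symmetric])
        then show ?thesis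
          using that[of "(t / (t + s)) *\<^sub>R c + (s / (t + s)) *\<^sub>R d"] False
          by (simp add: scaleR_add_right)
      qed
      have "q (x + y) \<le> p ((x + y) + (t + s) *\<^sub>R e) - (t + s) * b"
        using t s e by (intro lower) auto
      also have "(x + y) + (t + s) *\<^sub>R e = (x + t *\<^sub>R c) + (y + s *\<^sub>R d)"
        using e by (simp add: algebra_simps)
      also have "p \<dots> \<le> p (x + t *\<^sub>R c) + p (y + s *\<^sub>R d)" using p by (rule sublinear_add)
      finally show ?thesis by (simp add: algebra_simps)
    qed
    have "q (x + y) - q y \<le> p (x + t *\<^sub>R c) - t * b" if "0 \<le> t" "c \<in> C" for t c
    proof -
      have "q (x + y) - (p (x + t *\<^sub>R c) - t * b) \<le> q y"
        using main[OF that] by (intro greatest) (smt (verit))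
      then show ?thesis by simp
    qed
    then have "q (x + y) - q y \<le> q x" by (rule greatest)
    then show "q (x + y) \<le> q x + q y" by simp
  next
    fix r :: real and x assume r: "0 < r"
    have "q (r *\<^sub>R x) / r \<le> q x"
    proof (rule greatest)
      fix t c assume t: "0 \<le> (t::real)" and c: "c \<in> C"
      have "q (r *\<^sub>R x) \<le> p (r *\<^sub>R x + (r * t) *\<^sub>R c) - (r * t) * b"
        using t r c by (intro lower) auto
      also have "r *\<^sub>R x + (r * t) *\<^sub>R c = r *\<^sub>R (x + t *\<^sub>R c)" by (simp add: algebra_simps)
      also have "p \<dots> = r * p (x + t *\<^sub>R c)" using r by (intro sublinear_scaleR[OF p]) simp
      finally show "q (r *\<^sub>R x) / r \<le> p (x + t *\<^sub>R c) - t * b" using r by (simp add: field_simps)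
    qed
    then show "q (r *\<^sub>R x) \<le> r * q x" using r by (simp add: field_simps)
  next
    show "q 0 \<le> 0" using lower[of 0 c0 0] c0 sublinear_0[OF p] by simp
  qed
  moreover have "q \<le> p" using lower[of 0 c0] c0 by (auto simp: le_fun_def)
  moreover have "q (- c) \<le> - b" if "c \<in> C" for c
    using lower[of 1 c "- c"] that sublinear_0[OF p] by simp
  ultimately show ?thesis using that by blast
qed

text \<open>Linear functionals are the minimal sublinear ones: Zorn's lemma supplies a minimal
  sublinear \<open>m\<close> below \<open>p\<close>, lowering it on the point \<open>x\<close> changes nothing, so \<open>m (- x) = - m x\<close>,
  and an odd sublinear functional is linear.\<close>

theorem Hahn_Banach_dominated:
  assumes p: "sublinear p"
  obtains f where "linear f" "f \<le> p"
proof -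
  define A where "A = {q. sublinear q \<and> q \<le> p}"
  have "\<exists>m\<in>A. \<forall>q\<in>A. q \<le> m \<longrightarrow> q = m"
  proof (rule predicate_Zorn)
    show "partial_order_on A (relation_of (\<lambda>f g. g \<le> f) A)"
      by (rule partial_order_on_relation_ofI) auto
  next
    fix F assume F: "F \<in> Chains (relation_of (\<lambda>f g. g \<le> f) A)"
    then have FA: "F \<subseteq> A" and chain: "\<And>f g. f \<in> F \<Longrightarrow> g \<in> F \<Longrightarrow> f \<le> g \<or> g \<le> f"
      by (auto simp: Chains_def relation_of_def)
    show "\<exists>u\<in>A. \<forall>f\<in>F. u \<le> f"
    proof (cases "F = {}")
      case True
      then show ?thesis using p by (auto simp: A_def)
    next
      case False
      note m = sublinear_Inf_chain[OF False _ chain]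
      have sub: "sublinear f" if "f \<in> F" for f using that FA by (auto simp: A_def)
      have le: "(\<lambda>x. INF f\<in>F. f x) \<le> f" if "f \<in> F" for f
        using m(2)[OF sub _ _ that] by (auto simp: le_fun_def)
      obtain f0 where "f0 \<in> F" using False by blast
      then have "(\<lambda>x. INF f\<in>F. f x) \<le> p" using le FA order_trans unfolding A_def by blast
      then show ?thesis using m(1)[OF sub] le unfolding A_def by blast
    qed
  qed
  then obtain m where m: "sublinear m" "m \<le> p"
    and min: "\<And>q. sublinear q \<Longrightarrow> q \<le> m \<Longrightarrow> q = m"
    unfolding A_def by (metis (mono_tags, lifting) mem_Collect_eq order_trans)
  have odd: "m (- x) = - m x" for x
  proof -
    obtain q where "sublinear q" "q \<le> m" "q (- x) \<le> - m x"
      using sublinear_lower_on_convex[OF m(1), of "{x}" "m x"] by auto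
    then have "m (- x) \<le> - m x" using min by blast
    then show ?thesis using sublinear_ge_neg[OF m(1), of x] by simp
  qed
  have "linear m"
  proof (rule linearI)
    fix x y
    have "m (- x - y) \<le> m (- x) + m (- y)" using sublinear_add[OF m(1), of "- x" "- y"] by simp
    then have "m x + m y \<le> m (x + y)" using odd[of x] odd[of y] odd[of "x + y"] by simp
    then show "m (x + y) = m x + m y" using sublinear_add[OF m(1), of x y] by simp
  next
    fix r :: real and x
    show "m (r *\<^sub>R x) = r *\<^sub>R m x"
    proof (cases "0 \<le> r")
      case True
      then show ?thesis using sublinear_scaleR[OF m(1)] by simp
    next
      case False
      then show ?thesis using sublinear_scaleR[OF m(1), of "- r" x] odd[of "r *\<^sub>R x"] by simp
    qed
  qed
  then show ?thesis using m that by blast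
qed

text \<open>After translating \<open>x\<close> to the origin, the set \<open>C\<close> lies at a positive distance \<open>d\<close> from it, so the
  norm can be lowered to \<open>-d\<close> on the negated set; a linear functional below the result is bounded
  by the norm and at least \<open>d\<close> on the translated set.\<close>

theorem separation_point_closed_convex:
  fixes C :: "'a::real_normed_vector set"
  assumes C: "closed C" "convex C" and x: "x \<notin> C"
  obtains f :: "'a \<Rightarrow>\<^sub>L real" and d where "0 < d" "\<And>c. c \<in> C \<Longrightarrow> blinfun_apply f x + d \<le> blinfun_apply f c"
proof (cases "C = {}")
  case True
  then show ?thesis using that[of 1 0] by simp
next
  case False
  define d where "d = infdist x C"
  have d: "0 < d" unfolding d_def using C False x by (intro infdist_pos_not_in_closed)
  have "sublinear (norm :: 'a \<Rightarrow> real)"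
    by (rule sublinearI) (auto intro: norm_triangle_ineq)
  moreover have "convex ((\<lambda>c. c - x) ` C)" using C(2) by simp
  moreover have "d \<le> norm v" if "v \<in> (\<lambda>c. c - x) ` C" for v
    using that infdist_le[of _ C x] by (auto simp: d_def dist_norm norm_minus_commute)
  ultimately obtain q where q: "sublinear q" "q \<le> norm"
      "\<And>v. v \<in> (\<lambda>c. c - x) ` C \<Longrightarrow> q (- v) \<le> - d"
    using sublinear_lower_on_convex[of norm "(\<lambda>c. c - x) ` C" d] False by auto
  obtain f where f: "linear f" "f \<le> q" using Hahn_Banach_dominated[OF q(1)] .
  have fn: "f y \<le> norm y" for y using f(2) q(2) by (meson le_funD order_trans)
  have "bounded_linear f"
  proof (rule bounded_linear_intro[of _ 1])
    show "norm (f y) \<le> norm y * 1" for y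
      using fn[of y] fn[of "- y"] linear_neg[OF f(1), of y] by simp
  qed (simp_all add: f(1) linear_add linear_scale)
  then have app: "blinfun_apply (Blinfun f) = f" by (rule bounded_linear_Blinfun_apply)
  have "f x + d \<le> f c" if "c \<in> C" for c
  proof -
    have "f (- (c - x)) \<le> - d"
      using le_funD[OF f(2), of "- (c - x)"] q(3)[of "c - x"] that by auto
    then show ?thesis using linear_diff[OF f(1), of x c] by simp
  qed
  then show ?thesis using that[OF d, of "Blinfun f"] app by simp
qed

section \<open>Nested convex sets in reflexive spaces\<close>

text \<open>Smulian's theorem, in place of weak compactness. The functional
  \<open>\<lambda>f. INF n. SUP c\<in>C n. f c\<close> on the dual is sublinear and bounded; a linear functional below
  it belongs to the bidual, hence is evaluation at a point \<open>x\<close>. This \<open>x\<close> satisfies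
  \<open>f x \<le> (SUP c\<in>C n. f c)\<close> for all \<open>f\<close> and \<open>n\<close>, so no functional separates it from \<open>C n\<close>.\<close>

theorem nested_convex_Inter_nonempty:
  fixes C :: "nat \<Rightarrow> 'u::banach set"
  assumes refl: "reflexive_space TYPE('u)"
    and C: "\<And>n. closed (C n)" "\<And>n. convex (C n)" "\<And>n. C n \<noteq> {}"
    and dec: "decseq C" and bd: "bounded (C 0)"
  obtains x where "\<And>n. x \<in> C n"
proof -
  obtain B where B: "\<And>c. c \<in> C 0 \<Longrightarrow> norm c \<le> B" using bd by (auto simp: bounded_iff)
  have CB: "norm c \<le> B" if "c \<in> C n" for c n
    using B decseqD[OF dec, of 0 n] that by auto
  define p where "p n f = (SUP c\<in>C n. blinfun_apply f c)" for n and f :: "'u \<Rightarrow>\<^sub>L real"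
  have fB: "blinfun_apply f c \<le> B * norm f" if "c \<in> C n" for f :: "'u \<Rightarrow>\<^sub>L real" and c n
  proof -
    have "blinfun_apply f c \<le> norm f * norm c"
      using norm_blinfun[of f c] by simp
    also have "\<dots> \<le> norm f * B" using CB[OF that] by (intro mult_left_mono) auto
    finally show ?thesis by (simp add: mult.commute)
  qed
  have bdd: "bdd_above (blinfun_apply f ` C n)" for f :: "'u \<Rightarrow>\<^sub>L real" and n
    using fB by (intro bdd_aboveI2) auto
  have upper: "blinfun_apply f c \<le> p n f" if "c \<in> C n" for f c n
    unfolding p_def using that bdd by (rule cSUP_upper)
  have least: "p n f \<le> l" if "\<And>c. c \<in> C n \<Longrightarrow> blinfun_apply f c \<le> l" for f n l
    unfolding p_def using C(3) that by (rule cSUP_least)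
  have sub: "sublinear (p n)" for n
  proof (rule sublinearI)
    show "p n (f + g) \<le> p n f + p n g" for f g
      using upper[of _ n] by (intro least) (auto simp: plus_blinfun.rep_eq intro: add_mono)
    show "p n (t *\<^sub>R f) \<le> t * p n f" if "0 < t" for t f
      using upper[of _ n] that by (intro least) (auto simp: scaleR_blinfun.rep_eq)
    show "p n 0 \<le> 0" by (intro least) auto
  qed
  have anti: "p n \<le> p m" if "m \<le> n" for m n
    using decseqD[OF dec that] upper by (intro le_funI least) auto
  have chain: "q \<le> r \<or> r \<le> q" if qr: "q \<in> range p" "r \<in> range p" for q r
  proof -
    obtain m n where "q = p m" "r = p n" using qr by blast
    then show ?thesis using anti[of m n] anti[of n m] by (cases "m \<le> n") auto
  qed
  have rng: "sublinear q" if "q \<in> range p" for q using that sub by auto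
  note inf = sublinear_Inf_chain[OF _ rng chain]
  obtain L where L: "linear L" "L \<le> (\<lambda>f. INF q\<in>range p. q f)"
    using Hahn_Banach_dominated[OF inf(1)[of "range p"]] by blast
  have Lp: "L f \<le> p n f" for f n
    using le_funD[OF L(2), of f] inf(2)[where F = "range p" and p = "p n" and x = f] by (auto intro: order_trans)
  have "bounded_linear L"
  proof (rule bounded_linear_intro)
    have "L f \<le> norm f * B" for f
      using Lp[of f 0] least[of 0 f "B * norm f"] fB[of _ 0 f] by (auto simp: mult.commute intro: order_trans)
    note le = this
    show "norm (L f) \<le> norm f * B" for f
      using le[of f] le[of "- f"] linear_neg[OF L(1), of f] unfolding norm_minus_cancel real_norm_def
      by linarith
  qed (simp_all add: L(1) linear_add linear_scale)
  then have app: "blinfun_apply (Blinfun L) = L" by (rule bounded_linear_Blinfun_apply)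
  obtain x where "Blinfun L = bidual_embedding x"
    using refl unfolding reflexive_space_def by (rule surjE)
  then have x: "L f = blinfun_apply f x" for f
    using app bidual_embedding_apply[of x f] by simp
  have "x \<in> C n" for n
  proof (rule ccontr)
    assume n: "x \<notin> C n"
    obtain f :: "'u \<Rightarrow>\<^sub>L real" and d where f: "0 < d" "\<And>c. c \<in> C n \<Longrightarrow> blinfun_apply f x + d \<le> blinfun_apply f c"
      by (rule separation_point_closed_convex[OF C(1,2) n]) (rule that)
    have "p n (- f) \<le> - blinfun_apply f x - d"
      using f(2) by (intro least) (force simp: uminus_blinfun.rep_eq)
    then show False
      using Lp[of "- f" n] x[of "- f"] f(1) by (simp add: uminus_blinfun.rep_eq)
  qed
  then show ?thesis using that by blast
qed

section \<open>Convex minimization\<close>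

lemma lower_semicontinuous_iff_open:
  "lower_semicontinuous f \<longleftrightarrow> (\<forall>c. open {x. c < f x})"
proof
  assume lsc: "lower_semicontinuous f"
  show "\<forall>c. open {x. c < f x}"
  proof
    fix c
    show "open {x. c < f x}"
    proof (rule Topological_Spaces.openI)
      fix x assume "x \<in> {x. c < f x}"
      then have "eventually (\<lambda>y. c < f y) (nhds x)"
        using lsc by (simp add: lower_semicontinuous_def)
      then show "\<exists>T. open T \<and> x \<in> T \<and> T \<subseteq> {x. c < f x}"
        unfolding eventually_nhds by (simp add: subset_iff Ball_def)
    qed
  qed
next
  assume R: "\<forall>c. open {x. c < f x}"
  show "lower_semicontinuous f"
    unfolding lower_semicontinuous_def
  proof (intro allI impI)
    fix x c assume "c < f x"
    then show "eventually (\<lambda>y. c < f y) (nhds x)"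
      using eventually_nhds_in_open[of "{x. c < f x}" x] R by simp
  qed
qed

lemma lower_semicontinuous_closed_sublevel:
  assumes "lower_semicontinuous f"
  shows "closed {x. f x \<le> c}"
proof -
  have "open {x. c < f x}" using assms unfolding lower_semicontinuous_iff_open by blast
  moreover have "{x. f x \<le> c} = - {x. c < f x}" by auto
  ultimately show ?thesis by (metis closed_Compl)
qed

lemma lower_semicontinuous_compose:
  assumes "lower_semicontinuous f" "continuous_on UNIV g"
  shows "lower_semicontinuous (\<lambda>x. f (g x))"
  unfolding lower_semicontinuous_iff_open
proof
  fix c
  have "open (g -` {y. c < f y})"
    using assms(1) by (intro open_vimage[OF _ assms(2)]) (simp add: lower_semicontinuous_iff_open)
  then show "open {x. c < f (g x)}" by (simp add: vimage_def)
qed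

lemma lower_semicontinuous_borel_measurable:
  assumes "lower_semicontinuous f"
  shows "f \<in> borel_measurable borel"
  unfolding borel_measurable_iff_greater
proof
  fix c
  have "open {x. c < f x}" using assms by (simp add: lower_semicontinuous_iff_open)
  then show "{x \<in> space borel. c < f x} \<in> sets borel" by simp
qed

lemma convex_sublevel:
  assumes "convex_on S f"
  shows "convex {x \<in> S. f x \<le> c}"
proof (rule convexI)
  fix x y and u v :: real
  assume x: "x \<in> {x \<in> S. f x \<le> c}" and y: "y \<in> {x \<in> S. f x \<le> c}"
    and uv: "0 \<le> u" "0 \<le> v" "u + v = 1"
  have "f (u *\<^sub>R x + v *\<^sub>R y) \<le> u * f x + v * f y"
    using assms x y uv by (auto simp: convex_on_def)
  also have "\<dots> \<le> u * c + v * c" using x y uv by (intro add_mono mult_left_mono) auto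
  also have "\<dots> = c" using uv by (simp add: distrib_right[symmetric])
  finally show "u *\<^sub>R x + v *\<^sub>R y \<in> {x \<in> S. f x \<le> c}"
    using convexD[OF convex_on_imp_convex[OF assms]] x y uv by auto
qed

text \<open>By Baire, one of the closed sublevel sets \<open>{x. f x \<le> n}\<close> has an interior point \<open>a\<close>.
  Given any \<open>y\<close>, each point near \<open>y\<close> is the midpoint of \<open>2 *\<^sub>R y - a\<close> and a point near \<open>a\<close>, which
  bounds \<open>f\<close> above near \<open>y\<close>; since \<open>y\<close> is the midpoint of \<open>y + h\<close> and \<open>y - h\<close>, it is also
  bounded below there, and a convex function that is bounded on a ball is continuous in it.\<close>

theorem convex_lower_semicontinuous_imp_continuous:
  fixes f :: "'a::banach \<Rightarrow> real"
  assumes f: "convex_on UNIV f" and lsc: "lower_semicontinuous f"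
  shows "continuous_on UNIV f"
proof -
  have mid: "f ((1/2) *\<^sub>R x + (1/2) *\<^sub>R y) \<le> (f x + f y) / 2" for x y
    using convex_onD[OF f, of "1/2" x y] by simp
  define F where "F n = {x. f x \<le> real n}" for n
  have "\<exists>n. interior (F n) \<noteq> {}"
  proof (rule ccontr)
    assume "\<nexists>n. interior (F n) \<noteq> {}"
    then have "(euclidean :: 'a topology) interior_of \<Union>(range F) = {}"
      using lower_semicontinuous_closed_sublevel[OF lsc]
      by (intro Baire_category_alt) (auto simp: F_def completely_metrizable_space_euclidean)
    moreover have "\<Union>(range F) = UNIV"
      using real_arch_simple by (fastforce simp: F_def)
    ultimately show False by simp
  qed
  then obtain n a where "a \<in> interior (F n)" by blast
  then obtain r where r: "0 < r" "ball a r \<subseteq> F n" by (auto simp: mem_interior)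
  have "isCont f y" for y
  proof -
    define b where "b = (f (2 *\<^sub>R y - a) + real n) / 2"
    have up: "f (y + h) \<le> b" if "norm h < r / 2" for h
    proof -
      have "a + 2 *\<^sub>R h \<in> ball a r" using that by (simp add: dist_norm)
      then have "f (a + 2 *\<^sub>R h) \<le> real n" using r by (auto simp: F_def)
      moreover have "(1/2) *\<^sub>R (2 *\<^sub>R y - a) + (1/2) *\<^sub>R (a + 2 *\<^sub>R h) = y + h"
        by (simp add: algebra_simps)
      ultimately show ?thesis using mid[of "2 *\<^sub>R y - a" "a + 2 *\<^sub>R h"] by (simp add: b_def)
    qed
    have low: "2 * f y - b \<le> f (y + h)" if "norm h < r / 2" for h
    proof -
      have "(1/2) *\<^sub>R (y + h) + (1/2) *\<^sub>R (y + - h) = y" by (simp add: algebra_simps flip: scaleR_add_left)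
      then show ?thesis using mid[of "y + h" "y + - h"] up[of "- h"] that by simp
    qed
    have "\<bar>f x\<bar> \<le> \<bar>b\<bar> + \<bar>2 * f y - b\<bar>" if "x \<in> ball y (r / 2)" for x
      using up[of "x - y"] low[of "x - y"] that by (auto simp: dist_norm norm_minus_commute)
    then have "continuous_on (ball y (r / 2)) f"
      using f by (intro convex_on_bounded_continuous) (auto intro: convex_on_subset)
    then show ?thesis using r by (simp add: continuous_on_eq_continuous_at)
  qed
  then show ?thesis by (simp add: continuous_at_imp_continuous_on)
qed

lemma sublevels_attained:
  fixes f :: "'u::banach \<Rightarrow> real"
  assumes refl: "reflexive_space TYPE('u)"
    and C: "closed C" "bounded C" and f: "convex_on C f" "lower_semicontinuous f"
    and c: "decseq c" "\<And>n::nat. \<exists>u\<in>C. f u \<le> c n"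
  obtains u where "u \<in> C" "\<And>n. f u \<le> c n"
proof -
  let ?S = "\<lambda>n. {u \<in> C. f u \<le> c n}"
  obtain u where u: "\<And>n. u \<in> ?S n"
  proof (rule nested_convex_Inter_nonempty[OF refl, of ?S])
    fix n
    have "?S n = C \<inter> {u. f u \<le> c n}" by auto
    then show "closed (?S n)"
      using C lower_semicontinuous_closed_sublevel[OF f(2)] by auto
    show "convex (?S n)" by (rule convex_sublevel[OF f(1)])
    show "?S n \<noteq> {}" using c(2)[of n] by blast
  next
    show "decseq ?S"
      unfolding decseq_def
    proof (intro allI impI subsetI)
      fix m n u assume "m \<le> n" "u \<in> ?S n"
      then show "u \<in> ?S m" using decseqD[OF c(1), of m n] by simp
    qed
    show "bounded (?S 0)" using C(2) by (rule bounded_subset) auto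
  qed (rule that)
  show ?thesis using u by (intro that[of u]) auto
qed

text \<open>The attainment of decreasing levels is used twice: levels tending to \<open>-\<infinity>\<close> would be attained
  by a single point if \<open>f\<close> were unbounded below, and levels decreasing to the infimum give a
  minimizer.\<close>

theorem convex_attains_inf_bounded:
  fixes f :: "'u::banach \<Rightarrow> real"
  assumes refl: "reflexive_space TYPE('u)"
    and C: "closed C" "bounded C" "C \<noteq> {}" and f: "convex_on C f" "lower_semicontinuous f"
  obtains u where "u \<in> C" "\<And>v. v \<in> C \<Longrightarrow> f u \<le> f v"
proof -
  note attained = sublevels_attained[OF refl C(1,2) f]
  have bdd: "bdd_below (f ` C)"
  proof (rule ccontr)
    assume "\<not> bdd_below (f ` C)"
    then have low: "\<exists>u\<in>C. f u \<le> - real n" for n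
      unfolding bdd_below_def by (auto simp: not_le intro: less_imp_le)
    have dec: "decseq (\<lambda>n. - real n)" by (simp add: decseq_def)
    obtain u where "f u \<le> - real n" for n
      by (rule attained[OF dec low]) (rule that)
    moreover obtain n where "- f u < real n" using reals_Archimedean2 by blast
    ultimately show False by (smt (verit))
  qed
  define m where "m = Inf (f ` C)"
  have low: "\<exists>u\<in>C. f u \<le> m + 1 / Suc n" for n
  proof -
    have "Inf (f ` C) < m + 1 / Suc n" by (simp add: m_def)
    then show ?thesis using cInf_lessD[of "f ` C"] C(3) by (fastforce intro: less_imp_le)
  qed
  have dec: "decseq (\<lambda>n. m + 1 / Suc n)"
    by (auto simp: decseq_def intro!: divide_left_mono)
  obtain u where u: "u \<in> C" "\<And>n. f u \<le> m + 1 / Suc n"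
    by (rule attained[OF dec low]) (rule that)
  have "f u \<le> m"
    using u(2) by (intro LIMSEQ_le_const[OF LIMSEQ_inverse_real_of_nat_add[of m]])
      (auto simp: inverse_eq_divide)
  then have le: "f u \<le> f v" if "v \<in> C" for v
    using cInf_lower[OF imageI[OF that] bdd] by (simp add: m_def)
  show ?thesis using u(1) le by (rule that)
qed

lemma coercive_onD:
  assumes "coercive_on S f"
  obtains R where "\<And>u. u \<in> S \<Longrightarrow> R \<le> norm u \<Longrightarrow> c < f u"
proof -
  have "filterlim f at_top (inf at_infinity (principal S))"
    using assms by (simp only: coercive_on_def)
  then have "eventually (\<lambda>u. c < f u) (inf at_infinity (principal S))"
    by (simp only: filterlim_at_top_dense)
  then obtain R where R: "\<forall>u. R \<le> norm u \<longrightarrow> u \<in> S \<longrightarrow> c < f u"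
    by (auto simp only: eventually_inf_principal eventually_at_infinity)
  show ?thesis by (rule that[of R]) (use R in simp)
qed

lemma mem_argmin_on: "u \<in> argmin_on C f \<longleftrightarrow> u \<in> C \<and> (\<forall>v\<in>C. f u \<le> f v)"
  by (auto simp: argmin_on_def is_arg_min_def not_less)

theorem argmin_on_coercive_nonempty:
  fixes f :: "'u::banach \<Rightarrow> real"
  assumes refl: "reflexive_space TYPE('u)"
    and C: "closed C" "convex C" "C \<noteq> {}"
    and f: "convex_on C f" "lower_semicontinuous f" "coercive_on C f"
  shows "argmin_on C f \<noteq> {}"
proof -
  obtain u0 where u0: "u0 \<in> C" using C by blast
  obtain R where R: "\<And>u. u \<in> C \<Longrightarrow> R \<le> norm u \<Longrightarrow> f u0 < f u"
    using coercive_onD[OF f(3), of "f u0"] by blast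
  let ?B = "C \<inter> cball 0 R"
  have "\<not> R \<le> norm u0" using R[OF u0] by blast
  then have u0R: "u0 \<in> ?B" using u0 by simp
  have "convex_on ?B f"
    by (rule convex_on_subset[OF f(1)]) (use C(2) in \<open>auto intro: convex_Int\<close>)
  moreover have "closed ?B" "bounded ?B" "?B \<noteq> {}"
    using C(1) u0R bounded_cball by (auto intro: bounded_Int)
  ultimately obtain u where u: "u \<in> ?B" "\<And>v. v \<in> ?B \<Longrightarrow> f u \<le> f v"
    using convex_attains_inf_bounded[OF refl _ _ _ _ f(2), of ?B] by blast
  have "\<forall>v\<in>C. f u \<le> f v"
  proof
    fix v assume v: "v \<in> C"
    show "f u \<le> f v"
    proof (cases "v \<in> ?B")
      case False
      then have "f u0 < f v" using R v by auto
      then show ?thesis using u(2)[OF u0R] by simp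
    qed (rule u(2))
  qed
  then have "u \<in> argmin_on C f" using u(1) by (simp add: mem_argmin_on)
  then show ?thesis by blast
qed

lemma dense_le_continuous:
  fixes f :: "'a::topological_space \<Rightarrow> real"
  assumes "continuous_on UNIV f" "C \<subseteq> closure D" "\<And>e. e \<in> D \<Longrightarrow> l \<le> f e" "v \<in> C"
  shows "l \<le> f v"
proof -
  have "closed {v. l \<le> f v}"
    using assms(1) by (intro closed_Collect_le) auto
  then have "closure D \<subseteq> {v. l \<le> f v}" using assms(3) by (intro closure_minimal) auto
  then show ?thesis using assms by blast
qed

text \<open>Near-minimizers need not be close in norm to minimizers, but the distances from a
  fixed point \<open>x\<close> to the sets of near-minimizers converge to its distance to the minimizers: the sets of \<open>1 / Suc n\<close>-minimizers within distance
  \<open>c + 1 / Suc n\<close> of \<open>x\<close> are nested, closed, convex and bounded, so they have a common point.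
  The right-hand side only inspects values on the dense set \<open>D\<close>; it compares them with each other
  so that the minimal value, itself a function of a parameter in applications, stays out of it.\<close>

theorem infdist_argmin_on_le_iff:
  fixes f :: "'u::banach \<Rightarrow> real"
  assumes refl: "reflexive_space TYPE('u)" and C: "closed C"
    and f: "convex_on C f" "continuous_on UNIV f" and ne: "argmin_on C f \<noteq> {}"
    and D: "D \<subseteq> C" "C \<subseteq> closure D"
  shows "infdist x (argmin_on C f) \<le> c \<longleftrightarrow>
    (\<forall>n. \<exists>d\<in>D. dist x d < c + 1 / Suc n \<and> (\<forall>e\<in>D. f d < f e + 1 / Suc n))"
proof
  assume le: "infdist x (argmin_on C f) \<le> c"
  show "\<forall>n. \<exists>d\<in>D. dist x d < c + 1 / Suc n \<and> (\<forall>e\<in>D. f d < f e + 1 / Suc n)"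
  proof
    fix n
    have "infdist x (argmin_on C f) < c + 1 / Suc n"
      using le by (rule le_less_trans) simp
    then have "(INF a\<in>argmin_on C f. dist x a) < c + 1 / Suc n"
      using ne by (simp add: infdist_notempty)
    then obtain u where u: "u \<in> argmin_on C f" "dist x u < c + 1 / Suc n"
      using ne by (subst (asm) cINF_less_iff) auto
    let ?V = "{v. f v < f u + 1 / Suc n} \<inter> ball x (c + 1 / Suc n)"
    have "open ?V"
      using f(2) by (intro open_Int open_Collect_less) auto
    moreover have "u \<in> ?V" using u by auto
    moreover have "u \<in> closure D" using u(1) D(2) by (auto simp: mem_argmin_on)
    ultimately obtain d where d: "d \<in> D" "d \<in> ?V"
      by (meson closure_iff_nhds_not_empty disjoint_iff subset_refl)
    have "f u \<le> f e" if "e \<in> D" for e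
      using u(1) that D(1) by (auto simp: mem_argmin_on)
    then have "f d < f e + 1 / Suc n" if "e \<in> D" for e
      using d(2) that by fastforce
    then show "\<exists>d\<in>D. dist x d < c + 1 / Suc n \<and> (\<forall>e\<in>D. f d < f e + 1 / Suc n)"
      using d by auto
  qed
next
  assume R: "\<forall>n. \<exists>d\<in>D. dist x d < c + 1 / Suc n \<and> (\<forall>e\<in>D. f d < f e + 1 / Suc n)"
  obtain u0 where u0: "u0 \<in> argmin_on C f" using ne by blast
  define r where "r n = 1 / real (Suc n)" for n
  have r: "r n \<le> r m" if "m \<le> n" for m n
    using that by (auto simp: r_def intro!: divide_left_mono)
  have r0: "a \<le> b" if "\<And>n. a \<le> b + r n" for a b
    using that by (intro LIMSEQ_le_const[OF LIMSEQ_inverse_real_of_nat_add[of b]])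
      (auto simp: inverse_eq_divide r_def)
  define E where "E n = {u \<in> C. f u \<le> f u0 + r n} \<inter> cball x (c + r n)" for n
  have "closed (E n)" for n
  proof -
    have "E n = C \<inter> {u. f u \<le> f u0 + r n} \<inter> cball x (c + r n)" by (auto simp: E_def)
    moreover have "closed {u. f u \<le> f u0 + r n}" using f(2) by (intro closed_Collect_le) auto
    ultimately show ?thesis using C by auto
  qed
  moreover have "convex (E n)" for n
    unfolding E_def using convex_sublevel[OF f(1)] by (intro convex_Int) auto
  moreover have "E n \<noteq> {}" for n
  proof -
    obtain d where d: "d \<in> D" "dist x d < c + r n" "\<And>e. e \<in> D \<Longrightarrow> f d < f e + r n"
      using R unfolding r_def by blast
    have "f d - r n \<le> f u0"
    proof (rule dense_le_continuous[OF f(2) D(2)])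
      show "f d - r n \<le> f e" if "e \<in> D" for e using d(3)[OF that] by simp
      show "u0 \<in> C" using u0 by (simp add: mem_argmin_on)
    qed
    then have "d \<in> E n" using d D(1) by (auto simp: E_def)
    then show ?thesis by blast
  qed
  moreover have "decseq E"
    unfolding decseq_def
  proof (intro allI impI subsetI)
    fix m n u assume "m \<le> n" "u \<in> E n"
    then show "u \<in> E m" using r[of m n] by (auto simp: E_def)
  qed
  moreover have "bounded (E 0)" unfolding E_def using bounded_cball by (rule bounded_subset) auto
  ultimately obtain u where u: "\<And>n. u \<in> E n"
    using nested_convex_Inter_nonempty[OF refl, of E] by blast
  have "f u \<le> f u0" "dist x u \<le> c" using u by (auto simp: E_def intro: r0)
  moreover have "u \<in> C" using u by (auto simp: E_def)
  ultimately have "u \<in> argmin_on C f" using u0 by (auto simp: mem_argmin_on intro: order_trans)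
  then show "infdist x (argmin_on C f) \<le> c" using \<open>dist x u \<le> c\<close> by (rule infdist_le2)
qed

section \<open>Measurable selections\<close>

text \<open>The Kuratowski--Ryll-Nardzewski theorem. The selection is the limit of maps with values
  in a dense sequence \<open>d\<close>; the index chosen at stage \<open>n + 1\<close> is the least one whose point is
  within \<open>2^-(n+1)\<close> of \<open>\<Gamma> \<omega>\<close> and close to the point chosen before. Taking the least index keeps
  every stage measurable.\<close>

theorem measurable_selection_infdist:
  fixes \<Gamma> :: "'\<omega> \<Rightarrow> 'a::polish_space set"
  assumes closed: "\<And>\<omega>. \<omega> \<in> space M \<Longrightarrow> closed (\<Gamma> \<omega>)"
    and ne: "\<And>\<omega>. \<omega> \<in> space M \<Longrightarrow> \<Gamma> \<omega> \<noteq> {}"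
    and meas[measurable]: "\<And>x. (\<lambda>\<omega>. infdist x (\<Gamma> \<omega>)) \<in> borel_measurable M"
  obtains \<gamma> where "measurable_selection M \<Gamma> \<gamma>"
proof -
  obtain D :: "'a set" where D: "countable D" "\<And>S. open S \<Longrightarrow> S \<noteq> {} \<Longrightarrow> \<exists>d\<in>D. d \<in> S"
    by (rule countable_dense_setE) blast
  define d where "d = from_nat_into D"
  have "D \<noteq> {}" using D(2)[of UNIV] by auto
  then have dense: "\<exists>i. dist y (d i) < \<delta>" if "0 < \<delta>" for y \<delta>
    using D(2)[of "ball y \<delta>"] D(1) that by (auto simp: d_def) (metis from_nat_into_surj)
  define r where "r n = (1/2::real) ^ n" for n
  have r: "0 < r n" "r (Suc n) = r n / 2" for n by (auto simp: r_def)
  define k where "k = rec_nat (\<lambda>\<omega>. LEAST i. infdist (d i) (\<Gamma> \<omega>) < r 0)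
    (\<lambda>n kn \<omega>. LEAST i. infdist (d i) (\<Gamma> \<omega>) < r (Suc n) \<and> dist (d (kn \<omega>)) (d i) < 2 * r n)"
  have k0: "k 0 \<omega> = (LEAST i. infdist (d i) (\<Gamma> \<omega>) < r 0)" for \<omega> by (simp add: k_def)
  have kS: "k (Suc n) \<omega> =
      (LEAST i. infdist (d i) (\<Gamma> \<omega>) < r (Suc n) \<and> dist (d (k n \<omega>)) (d i) < 2 * r n)" for n \<omega>
    by (simp add: k_def)
  have km[measurable]: "k n \<in> measurable M (count_space UNIV)" for n
  proof (induction n)
    case 0
    show ?case unfolding k0[abs_def] by measurable
  next
    case (Suc n)
    note Suc[measurable]
    have [measurable]: "(\<lambda>\<omega>. dist (d (k n \<omega>)) (d i)) \<in> borel_measurable M" for i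
      by (rule measurable_compose[OF Suc]) simp
    show ?case unfolding kS[abs_def] by measurable
  qed
  have step: "\<exists>i. infdist (d i) (\<Gamma> \<omega>) < r (Suc n) \<and> dist (d l) (d i) < 2 * r n"
    if \<omega>: "\<omega> \<in> space M" and l: "infdist (d l) (\<Gamma> \<omega>) < r n" for \<omega> l n
  proof -
    have "(INF a\<in>\<Gamma> \<omega>. dist (d l) a) < r n" using l ne[OF \<omega>] by (simp add: infdist_notempty)
    then obtain y where y: "y \<in> \<Gamma> \<omega>" "dist (d l) y < r n"
      using ne[OF \<omega>] by (subst (asm) cINF_less_iff) auto
    obtain i where i: "dist y (d i) < r (Suc n)" using dense r by blast
    have "infdist (d i) (\<Gamma> \<omega>) < r (Suc n)"
      using infdist_le[OF y(1), of "d i"] i by (simp add: dist_commute)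
    moreover have "dist (d l) (d i) < 2 * r n"
      using dist_triangle[of "d l" "d i" y] y i r(1)[of n] unfolding r(2) by simp
    ultimately show ?thesis by blast
  qed
  have near: "infdist (d (k n \<omega>)) (\<Gamma> \<omega>) < r n" if \<omega>: "\<omega> \<in> space M" for n \<omega>
  proof (induction n)
    case 0
    obtain y where y: "y \<in> \<Gamma> \<omega>" using ne[OF \<omega>] by blast
    obtain i where "dist y (d i) < r 0" using dense r by blast
    then have "infdist (d i) (\<Gamma> \<omega>) < r 0"
      using infdist_le[OF y, of "d i"] by (simp add: dist_commute)
    then show ?case unfolding k0 by (rule LeastI)
  next
    case (Suc n)
    show ?case using LeastI_ex[OF step[OF \<omega> Suc]] unfolding kS by blast
  qed
  have jump: "dist (d (k n \<omega>)) (d (k (Suc n) \<omega>)) < 2 * r n" if \<omega>: "\<omega> \<in> space M" for n \<omega>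
    using LeastI_ex[OF step[OF \<omega> near[OF \<omega>]]] unfolding kS by blast
  have conv: "convergent (\<lambda>n. d (k n \<omega>))" if \<omega>: "\<omega> \<in> space M" for \<omega>
  proof -
    \<comment> \<open>The jump bound telescopes: \<open>2 * r n = 4 * r n - 4 * r (Suc n)\<close>.\<close>
    have "dist (d (k m \<omega>)) (d (k n \<omega>)) \<le> 4 * r m - 4 * r n" if "m \<le> n" for m n
      using that
    proof (induction n rule: dec_induct)
      case (step n)
      then show ?case
        using dist_triangle[of "d (k m \<omega>)" "d (k (Suc n) \<omega>)" "d (k n \<omega>)"] jump[OF \<omega>, of n] r(2)[of n]
        by simp
    qed simp
    then have bound: "dist (d (k m \<omega>)) (d (k n \<omega>)) \<le> 4 * r m" if "m \<le> n" for m n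
      using that r(1)[of n] by (smt (verit))
    have lim: "\<exists>N. 4 * r N < e" if "0 < e" for e
      using real_arch_pow_inv[of "e / 4" "1 / 2"] that by (auto simp: r_def mult.commute)
    have "Cauchy (\<lambda>n. d (k n \<omega>))"
      unfolding Cauchy_altdef2
    proof (intro allI impI)
      fix e :: real assume "0 < e"
      then obtain N where "4 * r N < e" using lim by blast
      then have "dist (d (k n \<omega>)) (d (k N \<omega>)) < e" if "N \<le> n" for n
        using bound[OF that] by (simp add: dist_commute)
      then show "\<exists>N. \<forall>n\<ge>N. dist (d (k n \<omega>)) (d (k N \<omega>)) < e" by blast
    qed
    then show ?thesis by (rule Cauchy_convergent)
  qed
  define \<gamma> where "\<gamma> \<omega> = lim (\<lambda>n. d (k n \<omega>))" for \<omega>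
  have lim: "(\<lambda>n. d (k n \<omega>)) \<longlonglongrightarrow> \<gamma> \<omega>" if "\<omega> \<in> space M" for \<omega>
    using conv[OF that] by (simp add: \<gamma>_def convergent_LIMSEQ_iff)
  have "\<gamma> \<in> borel_measurable M"
  proof (rule borel_measurable_LIMSEQ_metric)
    show "(\<lambda>\<omega>. d (k n \<omega>)) \<in> borel_measurable M" for n
      by (rule measurable_compose[OF km]) simp
  qed (rule lim)
  moreover have "\<gamma> \<omega> \<in> \<Gamma> \<omega>" if \<omega>: "\<omega> \<in> space M" for \<omega>
  proof -
    have "r \<longlonglongrightarrow> 0" unfolding r_def[abs_def] by (intro LIMSEQ_power_zero) simp
    then have "infdist (\<gamma> \<omega>) (\<Gamma> \<omega>) \<le> 0"
      using near[OF \<omega>] less_imp_le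
      by (intro LIMSEQ_le[OF tendsto_infdist[OF lim[OF \<omega>]]]) blast+
    then show ?thesis
      using in_closed_iff_infdist_zero[OF closed[OF \<omega>] ne[OF \<omega>]] infdist_nonneg[of "\<gamma> \<omega>" "\<Gamma> \<omega>"]
      by simp
  qed
  ultimately show ?thesis using that by (auto simp: measurable_selection_def)
qed

text \<open>Only countably many values of the integrand enter the description of the distance to the
  minimizers, so measurability for each fixed argument is enough.\<close>

theorem measurable_selection_argmin_on:
  fixes f :: "'\<omega> \<Rightarrow> 'u::{banach,polish_space} \<Rightarrow> real"
  assumes refl: "reflexive_space TYPE('u)"
    and C: "closed C" "convex C" "C \<noteq> {}"
    and f: "\<And>\<omega>. \<omega> \<in> space M \<Longrightarrow> convex_on UNIV (f \<omega>)"
      "\<And>\<omega>. \<omega> \<in> space M \<Longrightarrow> lower_semicontinuous (f \<omega>)"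
      "\<And>\<omega>. \<omega> \<in> space M \<Longrightarrow> coercive_on C (f \<omega>)"
    and meas[measurable]: "\<And>u. (\<lambda>\<omega>. f \<omega> u) \<in> borel_measurable M"
  obtains \<gamma> where "measurable_selection M (\<lambda>\<omega>. argmin_on C (f \<omega>)) \<gamma>"
proof -
  obtain D where D: "countable D" "D \<subseteq> C" "C \<subseteq> closure D" using Topology_Euclidean_Space.separable[of C] by blast
  have conv: "convex_on C (f \<omega>)" if "\<omega> \<in> space M" for \<omega>
    by (rule convex_on_subset[OF f(1)[OF that]]) (use C(2) in auto)
  have ne: "argmin_on C (f \<omega>) \<noteq> {}" if "\<omega> \<in> space M" for \<omega>
    using argmin_on_coercive_nonempty[OF refl C conv[OF that] f(2,3)[OF that]] .
  have cont: "continuous_on UNIV (f \<omega>)" if "\<omega> \<in> space M" for \<omega>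
    using f(1,2)[OF that] by (rule convex_lower_semicontinuous_imp_continuous)
  note dist = infdist_argmin_on_le_iff[OF refl C(1) conv cont ne D(2,3)]
  show ?thesis
  proof (rule measurable_selection_infdist)
    fix x
    show "(\<lambda>\<omega>. infdist x (argmin_on C (f \<omega>))) \<in> borel_measurable M"
      unfolding borel_measurable_iff_le
    proof
      fix c
      have "{\<omega> \<in> space M. infdist x (argmin_on C (f \<omega>)) \<le> c} = {\<omega> \<in> space M.
          \<forall>n. \<exists>d\<in>D. dist x d < c + 1 / Suc n \<and> (\<forall>e\<in>D. f \<omega> d < f \<omega> e + 1 / Suc n)}"
        using dist by auto
      also have "\<dots> \<in> sets M" using D(1) by measurable
      finally show "{\<omega> \<in> space M. infdist x (argmin_on C (f \<omega>)) \<le> c} \<in> sets M" .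
    qed
  next
    fix \<omega> assume \<omega>: "\<omega> \<in> space M"
    obtain u0 where u0: "u0 \<in> argmin_on C (f \<omega>)" using ne[OF \<omega>] by blast
    have "argmin_on C (f \<omega>) = C \<inter> {u. f \<omega> u \<le> f \<omega> u0}"
    proof (intro set_eqI iffI)
      fix u assume "u \<in> argmin_on C (f \<omega>)"
      then show "u \<in> C \<inter> {u. f \<omega> u \<le> f \<omega> u0}" using u0 by (simp add: mem_argmin_on)
    next
      fix u assume "u \<in> C \<inter> {u. f \<omega> u \<le> f \<omega> u0}"
      then show "u \<in> argmin_on C (f \<omega>)" using u0 by (force simp: mem_argmin_on)
    qed
    then show "closed (argmin_on C (f \<omega>))"
      using C(1) lower_semicontinuous_closed_sublevel[OF f(2)[OF \<omega>]] by (simp add: closed_Int)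
    show "argmin_on C (f \<omega>) \<noteq> {}" by (rule ne[OF \<omega>])
  qed (rule that)
qed

section \<open>The parametrized problem\<close>

instance separable_banach \<subseteq> polish_space ..

theorem theorem3p23:
  fixes P :: "'\<omega> measure"
    and Uad :: "'u::separable_banach set"
    and j :: "'u \<times> 'w::real_topological_vector \<Rightarrow> real"
    and K :: "'u \<Rightarrow> real"
    and W :: "'\<omega> \<Rightarrow> 'w"
    and \<phi> :: "'\<omega> \<Rightarrow> ('u \<Rightarrow>\<^sub>L real)"
    and \<epsilon> :: real
  assumes "reflexive_space TYPE('u)"
    and "prob_space P"
    and "\<epsilon> > 0"
    and "Uad \<noteq> {}" "closed Uad" "convex Uad"
    and "lower_semicontinuous j"
    and "\<And>w. proper_function (\<lambda>u. ereal (j (u, w)))"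
    and "\<And>w. convex_on UNIV (\<lambda>u. j (u, w))"
    and "proper_function (\<lambda>u. ereal (K u))"
    and "convex_on UNIV K"
    and "lower_semicontinuous K"
    and "\<exists>S. open S \<and> Uad \<subseteq> S \<and> (\<forall>u\<in>S. gateaux_differentiable_at K u)"
    and "complete_measure P"
    and "W \<in> measurable P borel"
    and "\<phi> \<in> measurable P borel"
    and "\<And>\<omega>. \<omega> \<in> space P \<Longrightarrow> coercive_on Uad (aux_objective K \<phi> \<epsilon> j W \<omega>)"
  shows "\<exists>\<gamma>. measurable_selection P (\<lambda>\<omega>. argmin_on Uad (aux_objective K \<phi> \<epsilon> j W \<omega>)) \<gamma>"
proof -
  let ?f = "aux_objective K \<phi> \<epsilon> j W"
  note refl = assms(1) and eps = assms(3) and C = assms(5,6,4)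
    and j_lsc = assms(7) and j_conv = assms(9) and K_conv = assms(11) and K_lsc = assms(12)
    and W = assms(15) and phi = assms(16) and coercive = assms(17)
  have conv: "convex_on UNIV (?f \<omega>)" for \<omega>
  proof -
    have "convex_on UNIV (blinfun_apply (\<phi> \<omega>))"
      by (auto simp: convex_on_def blinfun.add_right blinfun.scaleR_right)
    then have "convex_on UNIV (\<lambda>u. (K u + \<phi> \<omega> u) + \<epsilon> * j (u, W \<omega>))"
      using K_conv j_conv[of "W \<omega>"] eps by (intro convex_on_add convex_on_cmul) auto
    then show ?thesis by (simp add: aux_objective_def[abs_def])
  qed
  \<comment> \<open>Via continuity of the summands, which is preserved by sums.\<close>
  have lsc: "lower_semicontinuous (?f \<omega>)" for \<omega>
  proof -
    have "lower_semicontinuous (\<lambda>u. j (u, W \<omega>))"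
      by (intro lower_semicontinuous_compose[OF j_lsc] continuous_intros)
    then have "continuous_on UNIV (\<lambda>u. j (u, W \<omega>))"
      using j_conv by (intro convex_lower_semicontinuous_imp_continuous)
    moreover have "continuous_on UNIV K"
      using K_conv K_lsc by (rule convex_lower_semicontinuous_imp_continuous)
    ultimately have "continuous_on UNIV (?f \<omega>)"
      unfolding aux_objective_def[abs_def] by (intro continuous_intros)
    then show ?thesis
      by (auto simp: lower_semicontinuous_iff_open intro: open_Collect_less)
  qed
  have "(\<lambda>\<omega>. ?f \<omega> u) \<in> borel_measurable P" for u
  proof -
    have "(\<lambda>w. j (u, w)) \<in> borel_measurable borel"
      by (intro lower_semicontinuous_borel_measurable lower_semicontinuous_compose[OF j_lsc]
          continuous_intros)
    then have [measurable]: "(\<lambda>\<omega>. j (u, W \<omega>)) \<in> borel_measurable P"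
      using W by (rule measurable_compose[rotated])
    have "(\<lambda>f :: 'u \<Rightarrow>\<^sub>L real. blinfun_apply f u) \<in> borel_measurable borel"
      by (intro borel_measurable_continuous_onI continuous_intros)
    then have [measurable]: "(\<lambda>\<omega>. blinfun_apply (\<phi> \<omega>) u) \<in> borel_measurable P"
      using phi by (rule measurable_compose[rotated])
    show ?thesis unfolding aux_objective_def by measurable
  qed
  then obtain \<gamma> where "measurable_selection P (\<lambda>\<omega>. argmin_on Uad (?f \<omega>)) \<gamma>"
    using measurable_selection_argmin_on[OF refl C, of P ?f] conv lsc coercive by blast
  then show ?thesis by blast
qed

end
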